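(* In the setting of the context, assume that for every $\ell\in\{1,\dots,n_{\mathtt P}\}$ $$\alpha\boldsymbol{B}_{p,N+1}\hat y\le 0\qquad\text{for all vertices }\hat y\in V(\mathcal{Y}_\ell).$$ Let $x_0\in\mathbb{R}^{n_x}$, $\boldsymbol{u}\in\mathbb{R}^{n_u(N+1)}$, $\beta\in\mathbb{R}$. Then the robust constraint $$\sup\Big\{\alpha\boldsymbol{B}_{p,N+1}\boldsymbol{p}\ :\ \boldsymbol{p}\in\bigcup_{\ell=1}^{n_{\mathtt P}}\mathtt{P}_\ell(x_0,\boldsymbol{u})\Big\}\ \le\ \tilde\beta_N(x_0,\boldsymbol{u},\beta)$$ holds if and only if $$\max_{\ell\in\{1,\dots,n_{\mathtt P}\}}\ \inf\Big\{\boldsymbol{\gamma}_\ell^\top\boldsymbol{S}_\ell\boldsymbol{\zeta}(x_0,\boldsymbol{u})\ :\ \boldsymbol{\gamma}_\ell\in\mathbb{R}^{2N_c},\ \boldsymbol{\gamma}_\ell\ge0,\ \boldsymbol{B}_{p,N+1}^\top\alpha^\top+(\boldsymbol{S}_\ell\boldsymbol{G})^\top\boldsymbol{\gamma}_\ell=0\Big\}\ \le\ \tilde\beta_N(x_0,\boldsymbol{u},\beta).$$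
   Context: Let $N\ge 0$ and $n_x,n_u,n_c\ge1$ be integers, and $N_c=n_c(N+1)$. For $k=0,\dots,N$ let $A_k\in\mathbb{R}^{n_x\times n_x}$, $B_{u,k}\in\mathbb{R}^{n_x\times n_u}$, $B_{p,k}\in\mathbb{R}^{n_x\times n_c}$, $C_k\in\mathbb{R}^{n_c\times n_x}$, $D_{u,k}\in\mathbb{R}^{n_c\times n_u}$, $D_{p,k}\in\mathbb{R}^{n_c\times n_c}$ be the matrices of the system $x_{k+1}=A_kx_k+B_{u,k}u_k+B_{p,k}\boldsymbol{p}_k$, $\boldsymbol{q}_k=C_kx_k+D_{u,k}u_k+D_{p,k}\boldsymbol{p}_k$, and let $\boldsymbol{u},\boldsymbol{p},\boldsymbol{q}$ be the vectors obtained by stacking $u_k,\boldsymbol{p}_k,\boldsymbol{q}_k$ for $k=0,\dots,N$ (so $\boldsymbol{p},\boldsymbol{q}\in\mathbb{R}^{N_c}$). Stacked matrices. Set $\boldsymbol{A}_0=I$, $\boldsymbol{B}_{u,0}=0$, $\boldsymbol{B}_{p,0}=0$, and for $i=1,\dots,N+1$ let $\boldsymbol{A}_i=A_{i-1}\cdots A_0$; let $\boldsymbol{B}_{u,i}\in\mathbb{R}^{n_x\times n_u(N+1)}$ be the block row whose block number $k$ ($k=0,\dots,N$) is $A_{i-1}\cdots A_{k+1}B_{u,k}$ if $k<i$ (empty product $=I$) and $0$ otherwise; and define $\boldsymbol{B}_{p,i}\in\mathbb{R}^{n_x\times N_c}$ likewise with $B_{p,k}$ in place of $B_{u,k}$.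 Thus $x_i=\boldsymbol{A}_ix_0+\boldsymbol{B}_{u,i}\boldsymbol{u}+\boldsymbol{B}_{p,i}\boldsymbol{p}$. The matrix $\boldsymbol{C}$ has block rows $C_k\boldsymbol{A}_k$; $\boldsymbol{D}_u$ has block rows $C_k\boldsymbol{B}_{u,k}$ plus $D_{u,k}$ added in block column $k$; $\boldsymbol{D}_p\in\mathbb{R}^{N_c\times N_c}$ has block rows $C_k\boldsymbol{B}_{p,k}$ plus $D_{p,k}$ added in block column $k$ ($k=0,\dots,N$). Thus $\boldsymbol{q}=\boldsymbol{C}x_0+\boldsymbol{D}_u\boldsymbol{u}+\boldsymbol{D}_p\boldsymbol{p}$. Channels. Scalar channels are indexed by $c=j+k\,n_c\in\{1,\dots,N_c\}$ with $k\in\{0,\dots,N\}$, $j\in\{1,\dots,n_c\}$. Channel $c$ has a symmetric indefinite multiplier $M_c\in\mathbb{R}^{2\times2}$ with eigenvalues $\lambda_+>0>\lambda_-$ and unit eigenvectors $v_+,v_-$; put $V=\sqrt{\lambda_+}v_+$, $U=\sqrt{|\lambda_-|}v_-$, $g=V+U=[g_q,g_p]^\top$, $h=V-U=[h_q,h_p]^\top$, and $E_c=[g_p,h_p]^\top$, $F_c=[g_q,h_q]^\top\in\mathbb{R}^{2}$. Let $e_c\in\mathbb{R}^{1\times N_c}$ be the $c$-th standard basis row vector. Polyhedral pieces. All vector inequalities are componentwise. Let $G_c=F_ce_c\boldsymbol{D}_p+E_ce_c\in\mathbb{R}^{2\times N_c}$ and $\zeta_c(x_0,\boldsymbol{u})=F_ce_c(\boldsymbol{C}x_0+\boldsymbol{D}_u\boldsymbol{u})\in\mathbb{R}^2$;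 let $\boldsymbol{G}\in\mathbb{R}^{2N_c\times N_c}$ and $\boldsymbol{\zeta}(x_0,\boldsymbol{u})\in\mathbb{R}^{2N_c}$ be obtained by stacking $G_c$ and $\zeta_c$ vertically over $c=1,\dots,N_c$. Let $\boldsymbol{S}_1,\dots,\boldsymbol{S}_{n_{\mathtt P}}$ enumerate the $n_{\mathtt P}=2^{N_c}$ block-diagonal matrices $\mathrm{diag}(I_1,\dots,I_{N_c})\in\mathbb{R}^{2N_c\times2N_c}$ with each $I_c\in\{\mathbb{I}_2,-\mathbb{I}_2\}$, where $\mathbb{I}_2$ is the $2\times2$ identity. Define $\mathtt{P}_\ell(x_0,\boldsymbol{u})=\{\boldsymbol{p}\in\mathbb{R}^{N_c}:\boldsymbol{S}_\ell(\boldsymbol{\zeta}(x_0,\boldsymbol{u})+\boldsymbol{G}\boldsymbol{p})\ge0\}$. State constraint. A single scalar constraint $\alpha x_{N+1}\le\beta$ at final time is considered, with $\alpha\in\mathbb{R}^{1\times n_x}$ fixed and $\beta\in\mathbb{R}$. Put $\tilde\beta_N(x_0,\boldsymbol{u},\beta)=\beta-\alpha(\boldsymbol{A}_{N+1}x_0+\boldsymbol{B}_{u,N+1}\boldsymbol{u})$. Polytopes for the assumption. $\mathcal{Y}_\ell=\{y\in\mathbb{R}^{N_c}:\boldsymbol{S}_\ell\boldsymbol{G}y\ge0,\ \|y\|_1\le1\}$, and $V(\mathcal{Y}_\ell)$ is its set of vertices. Suprema and infima are taken in the extended reals, with $\sup\varnothing=-\infty$ and $\inf\varnothing=+\infty$.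 *)

theory Defs
  imports "HOL-Analysis.Analysis"
begin

text \<open>
  The index types \<open>'x\<close>, \<open>'u\<close>, \<open>'c\<close> and \<open>'t\<close> have \<open>n\<^sub>x\<close>, \<open>n\<^sub>u\<close>, \<open>n\<^sub>c\<close> and \<open>N + 1\<close> elements.
  Stacked vectors are indexed by pairs (block, position in the block); the scalar channel
  \<open>c = j + k n\<^sub>c\<close> is thus the pair \<open>(k, j) :: 't \<times> 'c\<close>, and \<open>N\<^sub>c = CARD('t \<times> 'c)\<close>.
  The linear order on \<open>'t\<close> identifies its elements with the time steps \<open>0, \<dots>, N\<close>.
  A record of type \<open>('x, 'u, 'c) ltv_system\<close> carries matrices for all \<open>k :: nat\<close>, but only those
  with \<open>k \<le> N\<close> are ever used.
\<close>

definition stage :: "'t::{finite,linorder} \<Rightarrow> nat" where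
  "stage t = card {s. s < t}"

record ('x, 'u, 'c) ltv_system =
  sysA :: "nat \<Rightarrow> real ^ 'x::finite ^ 'x"
  sysBu :: "nat \<Rightarrow> real ^ 'u::finite ^ 'x"
  sysBp :: "nat \<Rightarrow> real ^ 'c::finite ^ 'x"
  sysC :: "nat \<Rightarrow> real ^ 'x ^ 'c"
  sysDu :: "nat \<Rightarrow> real ^ 'u ^ 'c"
  sysDp :: "nat \<Rightarrow> real ^ 'c ^ 'c"

subsection \<open>Stacked matrices\<close>

text \<open>\<open>transition A k i\<close> is the product \<open>A (i - 1) ** \<dots> ** A k\<close>, and the identity if \<open>i \<le> k\<close>.\<close>

primrec transition :: "(nat \<Rightarrow> real ^ 'x::finite ^ 'x) \<Rightarrow> nat \<Rightarrow> nat \<Rightarrow> real ^ 'x ^ 'x" where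
  "transition A k 0 = mat 1"
| "transition A k (Suc i) = (if k \<le> i then A i ** transition A k i else mat 1)"

definition input_rows ::
    "(nat \<Rightarrow> real ^ 'x::finite ^ 'x) \<Rightarrow> (nat \<Rightarrow> real ^ 'm::finite ^ 'x) \<Rightarrow> nat
      \<Rightarrow> real ^ ('t::{finite,linorder} \<times> 'm) ^ 'x" where
  "input_rows A B i = (\<chi> r c. let k = stage (fst c) in
     if k < i then (transition A (Suc k) i ** B k) $ r $ snd c else 0)"

definition feedthrough ::
    "(nat \<Rightarrow> real ^ 'x::finite ^ 'x) \<Rightarrow> (nat \<Rightarrow> real ^ 'm::finite ^ 'x)
      \<Rightarrow> (nat \<Rightarrow> real ^ 'x ^ 'c::finite) \<Rightarrow> (nat \<Rightarrow> real ^ 'm ^ 'c)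
      \<Rightarrow> real ^ ('t::{finite,linorder} \<times> 'm) ^ ('t \<times> 'c)" where
  "feedthrough A B C D = (\<chi> r c. let k = stage (fst r) in
     (C k ** (input_rows A B k :: real ^ ('t \<times> 'm) ^ 'x)) $ snd r $ c
     + (if fst c = fst r then D k $ snd r $ snd c else 0))"

definition stackA :: "('x::finite, 'u::finite, 'c::finite) ltv_system \<Rightarrow> nat \<Rightarrow> real ^ 'x ^ 'x" where
  "stackA sys i = transition (sysA sys) 0 i"

definition stackBu :: "('x::finite, 'u::finite, 'c::finite) ltv_system \<Rightarrow> nat
      \<Rightarrow> real ^ ('t::{finite,linorder} \<times> 'u) ^ 'x" where
  "stackBu sys i = input_rows (sysA sys) (sysBu sys) i"

definition stackBp :: "('x::finite, 'u::finite, 'c::finite) ltv_system \<Rightarrow> nat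
      \<Rightarrow> real ^ ('t::{finite,linorder} \<times> 'c) ^ 'x" where
  "stackBp sys i = input_rows (sysA sys) (sysBp sys) i"

definition stackC :: "('x::finite, 'u::finite, 'c::finite) ltv_system
      \<Rightarrow> real ^ 'x ^ ('t::{finite,linorder} \<times> 'c)" where
  "stackC sys = (\<chi> r. let k = stage (fst r) in (sysC sys k ** stackA sys k) $ snd r)"

definition stackDu :: "('x::finite, 'u::finite, 'c::finite) ltv_system
      \<Rightarrow> real ^ ('t::{finite,linorder} \<times> 'u) ^ ('t \<times> 'c)" where
  "stackDu sys = feedthrough (sysA sys) (sysBu sys) (sysC sys) (sysDu sys)"

definition stackDp :: "('x::finite, 'u::finite, 'c::finite) ltv_system
      \<Rightarrow> real ^ ('t::{finite,linorder} \<times> 'c) ^ ('t \<times> 'c)" where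
  "stackDp sys = feedthrough (sysA sys) (sysBp sys) (sysC sys) (sysDp sys)"

subsection \<open>Channels\<close>

text \<open>Component 1 of a vector in \<open>real ^ 2\<close> is its \<open>q\<close>-part, component 2 its \<open>p\<close>-part.\<close>

record multiplier =
  mulM :: "real ^ 2 ^ 2"
  eval_pos :: real
  eval_neg :: real
  evec_pos :: "real ^ 2"
  evec_neg :: "real ^ 2"

definition indefinite_multiplier :: "multiplier \<Rightarrow> bool" where
  "indefinite_multiplier m \<longleftrightarrow>
     transpose (mulM m) = mulM m \<and>
     eval_pos m > 0 \<and> eval_neg m < 0 \<and>
     norm (evec_pos m) = 1 \<and> norm (evec_neg m) = 1 \<and>
     mulM m *v evec_pos m = eval_pos m *\<^sub>R evec_pos m \<and>
     mulM m *v evec_neg m = eval_neg m *\<^sub>R evec_neg m"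

definition vecV :: "multiplier \<Rightarrow> real ^ 2" where
  "vecV m = sqrt (eval_pos m) *\<^sub>R evec_pos m"

definition vecU :: "multiplier \<Rightarrow> real ^ 2" where
  "vecU m = sqrt \<bar>eval_neg m\<bar> *\<^sub>R evec_neg m"

definition vecg :: "multiplier \<Rightarrow> real ^ 2" where
  "vecg m = vecV m + vecU m"

definition vech :: "multiplier \<Rightarrow> real ^ 2" where
  "vech m = vecV m - vecU m"

definition vecE :: "multiplier \<Rightarrow> real ^ 2" where
  "vecE m = vector [vecg m $ 2, vech m $ 2]"

definition vecF :: "multiplier \<Rightarrow> real ^ 2" where
  "vecF m = vector [vecg m $ 1, vech m $ 1]"

subsection \<open>Polyhedral pieces\<close>

definition erow :: "'k::finite \<Rightarrow> real ^ 'k ^ 1" where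
  "erow c = rowvector (axis c 1)"

definition blockG :: "('x::finite, 'u::finite, 'c::finite) ltv_system
      \<Rightarrow> ('t::{finite,linorder} \<times> 'c \<Rightarrow> multiplier) \<Rightarrow> 't \<times> 'c \<Rightarrow> real ^ ('t \<times> 'c) ^ 2" where
  "blockG sys mul c =
     columnvector (vecF (mul c)) ** erow c ** stackDp sys
     + columnvector (vecE (mul c)) ** erow c"

definition blockzeta :: "('x::finite, 'u::finite, 'c::finite) ltv_system
      \<Rightarrow> ('t::{finite,linorder} \<times> 'c \<Rightarrow> multiplier) \<Rightarrow> real ^ 'x \<Rightarrow> real ^ ('t \<times> 'u)
      \<Rightarrow> 't \<times> 'c \<Rightarrow> real ^ 2" where
  "blockzeta sys mul x0 u c =
     (columnvector (vecF (mul c)) ** erow c) *v (stackC sys *v x0 + stackDu sys *v u)"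

definition stackG :: "('x::finite, 'u::finite, 'c::finite) ltv_system
      \<Rightarrow> ('t::{finite,linorder} \<times> 'c \<Rightarrow> multiplier) \<Rightarrow> real ^ ('t \<times> 'c) ^ (('t \<times> 'c) \<times> 2)" where
  "stackG sys mul = (\<chi> r. blockG sys mul (fst r) $ snd r)"

definition stackzeta :: "('x::finite, 'u::finite, 'c::finite) ltv_system
      \<Rightarrow> ('t::{finite,linorder} \<times> 'c \<Rightarrow> multiplier) \<Rightarrow> real ^ 'x \<Rightarrow> real ^ ('t \<times> 'u)
      \<Rightarrow> real ^ (('t \<times> 'c) \<times> 2)" where
  "stackzeta sys mul x0 u = (\<chi> r. blockzeta sys mul x0 u (fst r) $ snd r)"

definition block_diag :: "('k::finite \<Rightarrow> real ^ 2 ^ 2) \<Rightarrow> real ^ ('k \<times> 2) ^ ('k \<times> 2)" where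
  "block_diag J = (\<chi> r s. if fst r = fst s then J (fst r) $ snd r $ snd s else 0)"

definition sign_matrices :: "(real ^ ('k::finite \<times> 2) ^ ('k \<times> 2)) set" where
  "sign_matrices = {block_diag J | J. \<forall>c. J c \<in> {mat 1, - mat 1}}"

text \<open>The order on \<open>real ^ 'n\<close> is the componentwise one.\<close>

definition piece :: "real ^ 'm::finite ^ 'm \<Rightarrow> real ^ 'm \<Rightarrow> real ^ 'n::finite ^ 'm
      \<Rightarrow> (real ^ 'n) set" where
  "piece S \<zeta> G = {p. 0 \<le> S *v (\<zeta> + G *v p)}"

definition polyY :: "real ^ 'm::finite ^ 'm \<Rightarrow> real ^ 'n::finite ^ 'm \<Rightarrow> (real ^ 'n) set" where
  "polyY S G = {y. 0 \<le> (S ** G) *v y \<and> (\<Sum>c\<in>UNIV. \<bar>y $ c\<bar>) \<le> 1}"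

definition dual_feasible :: "real ^ 'm::finite ^ 'm \<Rightarrow> real ^ 'n::finite ^ 'm
      \<Rightarrow> real ^ 'n ^ 'x::finite \<Rightarrow> real ^ 'x \<Rightarrow> (real ^ 'm) set" where
  "dual_feasible S G B \<alpha> = {\<gamma>. 0 \<le> \<gamma> \<and> transpose B *v \<alpha> + transpose (S ** G) *v \<gamma> = 0}"

definition tilde_beta :: "('x::finite, 'u::finite, 'c::finite) ltv_system \<Rightarrow> real ^ 'x \<Rightarrow> nat
      \<Rightarrow> real ^ 'x \<Rightarrow> real ^ ('t::{finite,linorder} \<times> 'u) \<Rightarrow> real \<Rightarrow> real" where
  "tilde_beta sys \<alpha> N x0 u \<beta> =
     \<beta> - \<alpha> \<bullet> (stackA sys (N + 1) *v x0 + stackBu sys (N + 1) *v u)"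

end

theory Submission
  imports Defs
begin

text \<open>
  The equivalence holds piece by piece: a supremum over a union is bounded by \<open>b\<close> iff the supremum
  over each part is, and a maximum is bounded by \<open>b\<close> iff each entry is. On a single piece the claim
  is linear programming duality between
  \<open>sup {a \<bullet> p | 0 \<le> z + M p}\<close> and \<open>inf {\<gamma> \<bullet> z | \<gamma> \<ge> 0, a + M\<^sup>T \<gamma> = 0}\<close>.

  Weak duality gives one direction. The other could fail only if both programs are infeasible, where
  the values are \<open>-\<infinity>\<close> and \<open>+\<infinity>\<close>; the assumption on the vertices excludes this. By
  Krein--Milman it extends from the vertices to the whole polytope \<open>{y. 0 \<le> M y, \<parallel>y\<parallel>\<^sub>1 \<le> 1}\<close>, and by scaling
  to the recession cone \<open>{y. 0 \<le> M y}\<close> (\<open>nonpos_on_recession_cone\<close>). With \<open>a \<bullet> y \<le> 0\<close> on that cone,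
  Farkas' lemma in affine form (\<open>affine_farkas\<close>) turns a primal bound \<open>b\<close> into a dual point of value at most \<open>b\<close>,
  whether or not the piece is empty.
\<close>

section \<open>Farkas' lemma\<close>

text \<open>A finitely generated cone is closed, so a point outside it is strictly separated from it;
  as the cone is invariant under scaling, the separating functional is nonnegative on the cone.\<close>

lemma farkas:
  fixes v :: "'i \<Rightarrow> 'a::euclidean_space"
  assumes "finite I"
    and nonneg: "\<And>y. (\<And>i. i \<in> I \<Longrightarrow> 0 \<le> v i \<bullet> y) \<Longrightarrow> 0 \<le> b \<bullet> y"
  shows "\<exists>c. (\<forall>i\<in>I. 0 \<le> c i) \<and> b = (\<Sum>i\<in>I. c i *\<^sub>R v i)"
proof -
  define H where "H = convex_cone hull (v ` I)"
  have cone: "convex_cone H"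
    unfolding H_def by (rule convex_cone_convex_cone_hull)
  have gen: "v i \<in> H" if "i \<in> I" for i
    unfolding H_def using that by (intro hull_inc) simp
  have "b \<in> H"
  proof (rule ccontr)
    assume "b \<notin> H"
    moreover have "convex H"
      using cone by (simp add: convex_cone_def)
    moreover have "closed H"
      unfolding H_def using assms(1) by (intro closed_convex_cone_hull finite_imageI)
    ultimately obtain y k where k: "y \<bullet> b < k" "\<And>x. x \<in> H \<Longrightarrow> k < y \<bullet> x"
      using separating_hyperplane_closed_point[of H b] by blast
    have "0 \<in> H"
      unfolding H_def by (rule convex_cone_hull_contains_0)
    then have "k < 0"
      using k(2) by fastforce
    have "0 \<le> v i \<bullet> y" if "i \<in> I" for i
    proof (rule ccontr)
      assume neg: "\<not> 0 \<le> v i \<bullet> y"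
      \<comment> \<open>This multiple of the generator lies on the separating hyperplane itself.\<close>
      have "(k / (v i \<bullet> y)) *\<^sub>R v i \<in> H"
        using cone gen[OF that] neg \<open>k < 0\<close>
        by (simp add: convex_cone_def conic_def divide_nonpos_neg)
      from k(2)[OF this] neg show False
        by (simp add: inner_commute)
    qed
    then have "0 \<le> b \<bullet> y"
      by (rule nonneg)
    with k(1) \<open>k < 0\<close> show False
      by (simp add: inner_commute)
  qed
  also have "H \<subseteq> {x. \<exists>c. (\<forall>i\<in>I. 0 \<le> c i) \<and> x = (\<Sum>i\<in>I. c i *\<^sub>R v i)}" (is "_ \<subseteq> ?K")
    unfolding H_def
  proof (rule hull_minimal)
    show "v ` I \<subseteq> ?K"
    proof clarsimp
      fix i assume "i \<in> I"
      then show "\<exists>c. (\<forall>i\<in>I. 0 \<le> c i) \<and> v i = (\<Sum>j\<in>I. c j *\<^sub>R v j)"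
        using assms(1)
        by (intro exI[of _ "\<lambda>j. if j = i then 1 else 0"])
           (simp add: if_distrib[of "\<lambda>r. r *\<^sub>R _"] cong: if_cong)
    qed
    show "convex_cone ?K"
      unfolding convex_cone_iff
    proof (intro conjI ballI allI impI)
      fix x y assume "x \<in> ?K" "y \<in> ?K"
      then obtain c d where "\<forall>i\<in>I. 0 \<le> c i" "\<forall>i\<in>I. 0 \<le> d i"
        "x = (\<Sum>i\<in>I. c i *\<^sub>R v i)" "y = (\<Sum>i\<in>I. d i *\<^sub>R v i)"
        by blast
      then show "x + y \<in> ?K"
        by (auto simp: scaleR_left_distrib sum.distrib intro!: exI[of _ "\<lambda>i. c i + d i"])
    next
      fix x :: 'a and r :: real assume "x \<in> ?K" "0 \<le> r"
      then obtain c where "\<forall>i\<in>I. 0 \<le> c i" "x = (\<Sum>i\<in>I. c i *\<^sub>R v i)"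
        by blast
      with \<open>0 \<le> r\<close> show "r *\<^sub>R x \<in> ?K"
        by (auto simp: scaleR_right.sum intro!: exI[of _ "\<lambda>i. r * c i"])
    qed (auto intro: exI[of _ "\<lambda>_. 0"])
  qed
  finally show ?thesis
    by blast
qed

text \<open>Homogenisation: in one more dimension, with generators the extended rows \<open>(M\<^sub>i, z\<^sub>i)\<close> and
  \<open>(0, 1)\<close>, the target is \<open>(- a, b)\<close>. The points \<open>(y, t)\<close> to be tested are scalings of points
  of the polyhedron if \<open>t > 0\<close>, and lie in its recession cone if \<open>t = 0\<close>. The latter have a hypothesis
  of their own, since an empty polyhedron says nothing about them.\<close>

lemma affine_farkas:
  fixes M :: "real ^ 'n::finite ^ 'm::finite"
  assumes poly: "\<And>p. 0 \<le> z + M *v p \<Longrightarrow> a \<bullet> p \<le> b"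
    and recession: "\<And>y. 0 \<le> M *v y \<Longrightarrow> a \<bullet> y \<le> 0"
  shows "\<exists>\<gamma>. 0 \<le> \<gamma> \<and> a + transpose M *v \<gamma> = 0 \<and> \<gamma> \<bullet> z \<le> b"
proof -
  define v :: "'m option \<Rightarrow> (real ^ 'n) \<times> real"
    where "v i = (case i of None \<Rightarrow> (0, 1) | Some i \<Rightarrow> (row i M, z $ i))" for i
  have row: "row i M \<bullet> y = (M *v y) $ i" for i y
    by (simp add: row_def inner_vec_def matrix_vector_mult_def)
  have "0 \<le> (- a, b) \<bullet> w" if w: "\<And>i. i \<in> UNIV \<Longrightarrow> 0 \<le> v i \<bullet> w" for w
  proof -
    obtain y t where [simp]: "w = (y, t)"
      by fastforce
    have t: "0 \<le> t"
      using w[of None] by (simp add: v_def)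
    have rows: "0 \<le> (M *v y) $ i + z $ i * t" for i
      using w[of "Some i"] by (simp add: v_def row)
    show ?thesis
    proof (cases "t = 0")
      case True
      with rows have "0 \<le> M *v y"
        by (simp add: less_eq_vec_def)
      from recession[OF this] True show ?thesis
        by simp
    next
      case False
      with t have "0 < t"
        by simp
      have "0 \<le> z $ i + (M *v (inverse t *\<^sub>R y)) $ i" for i
        using rows[of i] \<open>0 < t\<close>
        by (simp add: matrix_vector_mult_scaleR field_simps)
      then have "a \<bullet> (inverse t *\<^sub>R y) \<le> b"
        by (intro poly) (simp add: less_eq_vec_def)
      with \<open>0 < t\<close> show ?thesis
        by (simp add: field_simps)
    qed
  qed
  then have "\<exists>c. (\<forall>i\<in>UNIV. 0 \<le> c i) \<and> (- a, b) = (\<Sum>i\<in>UNIV. c i *\<^sub>R v i)"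
    by (intro farkas) simp_all
  then obtain c where c: "\<And>i. 0 \<le> c i"
    and eq: "(- a, b) = (\<Sum>i\<in>UNIV. c i *\<^sub>R v i)"
    by auto
  define \<gamma> where "\<gamma> = (\<chi> i. c (Some i))"
  have sum: "(- a, b) = c None *\<^sub>R (0, 1) + (\<Sum>i\<in>UNIV. \<gamma> $ i *\<^sub>R (row i M, z $ i))"
    unfolding eq by (simp add: UNIV_option_conv sum.reindex v_def \<gamma>_def)
  have "- a = (\<Sum>i\<in>UNIV. \<gamma> $ i *\<^sub>R row i M)"
    using arg_cong[OF sum, of fst] by (simp add: fst_sum)
  moreover have "transpose M *v \<gamma> = (\<Sum>i\<in>UNIV. \<gamma> $ i *\<^sub>R row i M)"
    by (simp add: vec_eq_iff matrix_vector_mult_def transpose_def row_def mult.commute)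
  ultimately have "a + transpose M *v \<gamma> = 0"
    by (metis add.right_inverse)
  moreover have "b = c None + \<gamma> \<bullet> z"
    using arg_cong[OF sum, of snd] by (simp add: snd_sum inner_vec_def)
  then have "\<gamma> \<bullet> z \<le> b"
    using c[of None] by simp
  moreover have "0 \<le> \<gamma>"
    using c by (simp add: less_eq_vec_def \<gamma>_def)
  ultimately show ?thesis
    by blast
qed

section \<open>Duality on one piece\<close>

lemma convex_polyY: "convex (polyY S G)"
proof (rule convexI)
  fix x y and r s :: real
  assume x: "x \<in> polyY S G" and y: "y \<in> polyY S G" and rs: "0 \<le> r" "0 \<le> s" "r + s = 1"
  have "(\<Sum>c\<in>UNIV. \<bar>(r *\<^sub>R x + s *\<^sub>R y) $ c\<bar>) \<le> (\<Sum>c\<in>UNIV. r * \<bar>x $ c\<bar> + s * \<bar>y $ c\<bar>)"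
    using rs by (intro sum_mono) (simp add: abs_mult order_trans[OF abs_triangle_ineq])
  also have "\<dots> = r * (\<Sum>c\<in>UNIV. \<bar>x $ c\<bar>) + s * (\<Sum>c\<in>UNIV. \<bar>y $ c\<bar>)"
    by (simp add: sum.distrib sum_distrib_left)
  also have "\<dots> \<le> 1"
    using x y rs by (intro convex_bound_le) (simp_all add: polyY_def)
  finally show "r *\<^sub>R x + s *\<^sub>R y \<in> polyY S G"
    using x y rs
    by (simp add: polyY_def less_eq_vec_def matrix_vector_right_distrib matrix_vector_mult_scaleR)
qed

lemma compact_polyY: "compact (polyY S G)"
proof -
  have "norm y \<le> 1" if "y \<in> polyY S G" for y
    using that norm_le_l1_cart[of y] by (simp add: polyY_def)
  then have "bounded (polyY S G)"
    by (auto simp: bounded_iff)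
  moreover have "closed (polyY S G)"
    unfolding polyY_def less_eq_vec_def
    by (intro closed_Collect_conj closed_Collect_all closed_Collect_le continuous_intros)
  ultimately show ?thesis
    by (simp add: compact_eq_bounded_closed)
qed

text \<open>The polytope is the convex hull of its vertices, and every recession direction is a multiple of
  one of its points.\<close>

lemma nonpos_on_recession_cone:
  assumes vertex: "\<And>y. y extreme_point_of polyY S G \<Longrightarrow> a \<bullet> y \<le> 0"
    and y: "0 \<le> (S ** G) *v y"
  shows "a \<bullet> y \<le> 0"
proof -
  have "convex hull {y. y extreme_point_of polyY S G} \<subseteq> {y. a \<bullet> y \<le> 0}"
    using vertex by (intro hull_minimal) (auto simp: convex_halfspace_le)
  then have nonpos: "a \<bullet> y \<le> 0" if "y \<in> polyY S G" for y
    using that Krein_Milman_Minkowski[OF compact_polyY convex_polyY] by blast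
  \<comment> \<open>The summand 1 covers \<open>y = 0\<close>.\<close>
  define n where "n = 1 + (\<Sum>c\<in>UNIV. \<bar>y $ c\<bar>)"
  have n: "0 < n" "(\<Sum>c\<in>UNIV. \<bar>y $ c\<bar>) \<le> n"
    by (simp_all add: n_def sum_nonneg add_pos_nonneg)
  have "inverse n *\<^sub>R y \<in> polyY S G"
    using y n
    by (simp add: polyY_def less_eq_vec_def matrix_vector_mult_scaleR abs_mult inverse_eq_divide
        flip: sum_divide_distrib)
  from nonpos[OF this] n show ?thesis
    by (simp add: mult_le_0_iff)
qed

text \<open>Both directions are about bounds rather than values, which avoids any case distinction on
  infeasible or unbounded programs.\<close>

lemma piece_bound_iff_dual_bound:
  assumes vertex: "\<And>y. y extreme_point_of polyY S G \<Longrightarrow> \<alpha> \<bullet> (B *v y) \<le> 0"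
  shows "(\<forall>p\<in>piece S \<zeta> G. \<alpha> \<bullet> (B *v p) \<le> b) \<longleftrightarrow>
         (INF \<gamma> \<in> dual_feasible S G B \<alpha>. ereal (\<gamma> \<bullet> (S *v \<zeta>))) \<le> ereal b"
proof -
  have adj: "x \<bullet> (M *v y) = (transpose M *v x) \<bullet> y" for M :: "real ^ 'k::finite ^ 'l::finite" and x y
    by (simp add: transpose_matrix_vector dot_lmul_matrix)
  define a where "a = transpose B *v \<alpha>"
  have a: "\<alpha> \<bullet> (B *v p) = a \<bullet> p" for p
    by (simp add: a_def adj)
  have piece: "p \<in> piece S \<zeta> G \<longleftrightarrow> 0 \<le> S *v \<zeta> + (S ** G) *v p" for p
    by (simp add: piece_def matrix_vector_right_distrib matrix_vector_mul_assoc)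
  show ?thesis
  proof
    assume primal: "\<forall>p\<in>piece S \<zeta> G. \<alpha> \<bullet> (B *v p) \<le> b"
    have "\<exists>\<gamma>. 0 \<le> \<gamma> \<and> a + transpose (S ** G) *v \<gamma> = 0 \<and> \<gamma> \<bullet> (S *v \<zeta>) \<le> b"
    proof (rule affine_farkas)
      show "a \<bullet> p \<le> b" if "0 \<le> S *v \<zeta> + (S ** G) *v p" for p
        using primal that by (simp add: piece a)
      show "a \<bullet> y \<le> 0" if "0 \<le> (S ** G) *v y" for y
        using nonpos_on_recession_cone[OF _ that] vertex by (simp add: a)
    qed
    then obtain \<gamma> where "\<gamma> \<in> dual_feasible S G B \<alpha>" "\<gamma> \<bullet> (S *v \<zeta>) \<le> b"
      by (auto simp: dual_feasible_def a_def)
    then show "(INF \<gamma> \<in> dual_feasible S G B \<alpha>. ereal (\<gamma> \<bullet> (S *v \<zeta>))) \<le> ereal b"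
      by (intro INF_lower2) simp_all
  next
    assume dual: "(INF \<gamma> \<in> dual_feasible S G B \<alpha>. ereal (\<gamma> \<bullet> (S *v \<zeta>))) \<le> ereal b"
    have weak: "a \<bullet> p \<le> \<gamma> \<bullet> (S *v \<zeta>)"
      if p: "p \<in> piece S \<zeta> G" and \<gamma>: "\<gamma> \<in> dual_feasible S G B \<alpha>" for p \<gamma>
    proof -
      have "0 \<le> \<gamma> \<bullet> (S *v \<zeta> + (S ** G) *v p)"
        using p \<gamma> by (auto simp: piece dual_feasible_def inner_vec_def less_eq_vec_def
            intro!: sum_nonneg mult_nonneg_nonneg)
      also have "\<dots> = \<gamma> \<bullet> (S *v \<zeta>) + (transpose (S ** G) *v \<gamma>) \<bullet> p"
        by (simp add: inner_add_right adj)
      also have "transpose (S ** G) *v \<gamma> = - a"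
        using \<gamma> by (simp add: dual_feasible_def a_def eq_neg_iff_add_eq_0 add.commute)
      finally show ?thesis
        by simp
    qed
    show "\<forall>p\<in>piece S \<zeta> G. \<alpha> \<bullet> (B *v p) \<le> b"
    proof
      fix p assume "p \<in> piece S \<zeta> G"
      then have "ereal (a \<bullet> p) \<le> (INF \<gamma> \<in> dual_feasible S G B \<alpha>. ereal (\<gamma> \<bullet> (S *v \<zeta>)))"
        by (intro INF_greatest) (simp add: weak)
      from order_trans[OF this dual] show "\<alpha> \<bullet> (B *v p) \<le> b"
        by (simp add: a)
    qed
  qed
qed

section \<open>The robust constraint\<close>

theorem mainTheorem3:
  fixes N :: nat
    and sys :: "('x::finite, 'u::finite, 'c::finite) ltv_system"
    and mul :: "'t::{finite,linorder} \<times> 'c \<Rightarrow> multiplier"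
    and S :: "nat \<Rightarrow> real ^ (('t \<times> 'c) \<times> 2) ^ (('t \<times> 'c) \<times> 2)"
    and n\<^sub>P :: nat
    and \<alpha> x0 :: "real ^ 'x"
    and u :: "real ^ ('t \<times> 'u)"
    and \<beta> :: real
  assumes "CARD('t) = N + 1"
    and "\<And>c. indefinite_multiplier (mul c)"
    and "n\<^sub>P = 2 ^ CARD('t \<times> 'c)"
    and "bij_betw S {1..n\<^sub>P} sign_matrices"
    and "\<And>l y. \<lbrakk>l \<in> {1..n\<^sub>P}; y extreme_point_of polyY (S l) (stackG sys mul)\<rbrakk>
           \<Longrightarrow> \<alpha> \<bullet> (stackBp sys (N + 1) *v y) \<le> 0"
  shows "(SUP p \<in> (\<Union>l\<in>{1..n\<^sub>P}. piece (S l) (stackzeta sys mul x0 u) (stackG sys mul)).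
            ereal (\<alpha> \<bullet> (stackBp sys (N + 1) *v p)))
           \<le> ereal (tilde_beta sys \<alpha> N x0 u \<beta>)
         \<longleftrightarrow>
         Max ((\<lambda>l. INF \<gamma> \<in> dual_feasible (S l) (stackG sys mul) (stackBp sys (N + 1)) \<alpha>.
                 ereal (\<gamma> \<bullet> (S l *v stackzeta sys mul x0 u))) ` {1..n\<^sub>P})
           \<le> ereal (tilde_beta sys \<alpha> N x0 u \<beta>)"
proof -
  have duality: "(\<forall>p\<in>piece (S l) (stackzeta sys mul x0 u) (stackG sys mul).
        \<alpha> \<bullet> (stackBp sys (N + 1) *v p) \<le> tilde_beta sys \<alpha> N x0 u \<beta>) \<longleftrightarrow>
      (INF \<gamma> \<in> dual_feasible (S l) (stackG sys mul) (stackBp sys (N + 1)) \<alpha>.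
          ereal (\<gamma> \<bullet> (S l *v stackzeta sys mul x0 u))) \<le> ereal (tilde_beta sys \<alpha> N x0 u \<beta>)"
    if "l \<in> {1..n\<^sub>P}" for l
    using assms(5)[OF that] by (rule piece_bound_iff_dual_bound)
  have "finite {1..n\<^sub>P}" "{1..n\<^sub>P} \<noteq> {}"
    using assms(3) by simp_all
  then show ?thesis
    by (simp only: SUP_le_iff ball_UN ereal_less_eq Max_le_iff finite_imageI image_is_empty
        ball_simps duality not_False_eq_True cong: ball_cong)
qed

end
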